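(* Let a region $R$ be split into $R_1,R_2$, so that $R=R_1\cup R_2$ and $R_1\cap R_2=\emptyset$. Let $C_i$, written in inequality form $A_iv\le b_i$, be the (sound) relaxation store for branch $R_i$, and fix a linear template $g^\top v$ (for instance a safety margin or an output coordinate). Assume that for $i\in\{1,2\}$ we have a dual bound certificate $\lambda_i\ge0$ such that $\lambda_i^\top A_i=g^\top$, and thus $g^\top v\le\beta_i$ for all $v$ satisfying $C_i$, where $\beta_i:=\lambda_i^\top b_i$. Define $\beta:=\max\{\beta_1,\beta_2\}$. Then the inequality $g^\top v\le\beta$ is valid for all exact-feasible points on the parent region $R$; hence it may be stored as a learned lemma at the parent (and reused globally whenever the same template $g$ applies).
   Context: Let $\mathcal N:\mathbb R^n\to\mathbb R^m$ be a feed-forward ReLU network ($z^{(0)}=x$, $s^{(i)}=W^{(i)}z^{(i-1)}+b^{(i)}$, $z^{(i)}=\sigma(s^{(i)})$, with $\sigma$ the ReLU on hidden layers and typically the identity on the output), and $D\subseteq\mathbb R^n$ a compact input domain; regions are subsets of $D$. The vector $v\in\mathbb R^N$ collects all network variables (inputs, pre-activations, post-activations and any auxiliary variables), and $g\in\mathbb Q^N$. An exact-feasible point on a region $R$ is an assignment $v$ consistent with the exact network semantics whose input part satisfies $x\in R$. A linear store is a finite set of rational linear constraints, normalized to $Av\le b$; it is a sound relaxation store for a region if every exact-feasible point on that region satisfies it. Certificates are rational vectors. The verifier explores a tree of regions obtained by successive splits of $D$; each node of the tree has its own store, and there is a global collection of learned linear inequalities (lemmas) that are injected into the stores of nodes.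 A learned linear lemma is an inequality $c^\top v\le\tau$ valid under the current node's exact constraints (or under its relaxation but proven globally valid), stored in that collection only with a checkable entailment certificate.
   Formalization: "Reused globally whenever the same template g applies" is proved only as reuse in every sound store of a region contained in the parent R (every node if R = D); reuse at nodes outside R is false in general, since the inequality is only valid on R. *)

theory Defs
  imports "HOL-Analysis.Function_Topology" "Jordan_Normal_Form.Matrix"
begin

text \<open>
  Vectors have run-time dimension (the types of Jordan_Normal_Form), because layer widths vary
  and stores are matrix inequalities over all network variables. Network parameters and assignments
  are real; stores, templates, bounds and certificates are rational and are embedded into the reals
  where they are evaluated.
\<close>

subsection \<open>Feed-forward ReLU networks and their variables\<close>

text \<open>
  Layers are numbered from 1 to depth, and width 0 is the input dimension. The output
  activation is left open, since it need not be the identity. Auxiliary variables are likewise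
  left open: their exact meaning is given by an arbitrary relation between the
  vector of all inputs, pre- and post-activations and the vector of auxiliary values.
\<close>

record network =
  depth :: nat
  width :: "nat \<Rightarrow> nat"
  weight :: "nat \<Rightarrow> real mat"
  bias :: "nat \<Rightarrow> real vec"
  out_act :: "real \<Rightarrow> real"
  aux_dim :: nat
  aux_rel :: "real vec \<Rightarrow> real vec \<Rightarrow> bool"

definition is_network :: "network \<Rightarrow> nat \<Rightarrow> nat \<Rightarrow> bool" where
  "is_network \<N> n m \<longleftrightarrow> 1 \<le> depth \<N> \<and> width \<N> 0 = n \<and> width \<N> (depth \<N>) = m \<and>
     (\<forall>i\<in>{1..depth \<N>}. weight \<N> i \<in> carrier_mat (width \<N> i) (width \<N> (i - 1)) \<and>
                       bias \<N> i \<in> carrier_vec (width \<N> i))"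

definition relu :: "real \<Rightarrow> real" where
  "relu t = max 0 t"

definition activation :: "network \<Rightarrow> nat \<Rightarrow> real \<Rightarrow> real" where
  "activation \<N> i = (if i < depth \<N> then relu else out_act \<N>)"

fun post :: "network \<Rightarrow> real vec \<Rightarrow> nat \<Rightarrow> real vec" where
  "post \<N> x 0 = x"
| "post \<N> x (Suc i) =
     map_vec (activation \<N> (Suc i)) (weight \<N> (Suc i) *\<^sub>v post \<N> x i + bias \<N> (Suc i))"

definition pre :: "network \<Rightarrow> real vec \<Rightarrow> nat \<Rightarrow> real vec" where
  "pre \<N> x i = weight \<N> i *\<^sub>v post \<N> x (i - 1) + bias \<N> i"

fun layer_vars :: "network \<Rightarrow> real vec \<Rightarrow> nat \<Rightarrow> real vec" where
  "layer_vars \<N> x 0 = x"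
| "layer_vars \<N> x (Suc i) = layer_vars \<N> x i @\<^sub>v (pre \<N> x (Suc i) @\<^sub>v post \<N> x (Suc i))"

definition num_vars :: "network \<Rightarrow> nat" where
  "num_vars \<N> = width \<N> 0 + (\<Sum>i=1..depth \<N>. 2 * width \<N> i) + aux_dim \<N>"

definition input_part :: "network \<Rightarrow> real vec \<Rightarrow> real vec" where
  "input_part \<N> v = vec_first v (width \<N> 0)"

definition exact_consistent :: "network \<Rightarrow> real vec \<Rightarrow> bool" where
  "exact_consistent \<N> v \<longleftrightarrow>
     (\<exists>x\<in>carrier_vec (width \<N> 0). \<exists>a\<in>carrier_vec (aux_dim \<N>).
        aux_rel \<N> (layer_vars \<N> x (depth \<N>)) a \<and> v = layer_vars \<N> x (depth \<N>) @\<^sub>v a)"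

definition exact_feasible :: "network \<Rightarrow> real vec set \<Rightarrow> real vec \<Rightarrow> bool" where
  "exact_feasible \<N> R v \<longleftrightarrow> exact_consistent \<N> v \<and> input_part \<N> v \<in> R"

text \<open>
  The vector type carries no topology, so compactness is that of the corresponding
  set of coordinate functions in the product topology on n copies of the real line.
\<close>

definition compact_domain :: "nat \<Rightarrow> real vec set \<Rightarrow> bool" where
  "compact_domain n D \<longleftrightarrow> D \<subseteq> carrier_vec n \<and>
     compactin (product_topology (\<lambda>i. euclideanreal) {..<n}) ((\<lambda>x. \<lambda>i\<in>{..<n}. x $ i) ` D)"

subsection \<open>Linear stores and valid inequalities\<close>

type_synonym lin_store = "rat mat \<times> rat vec"

definition is_store :: "nat \<Rightarrow> lin_store \<Rightarrow> bool" where
  "is_store N C \<longleftrightarrow> fst C \<in> carrier_mat (dim_row (fst C)) N \<and> snd C \<in> carrier_vec (dim_row (fst C))"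

definition satisfies :: "real vec \<Rightarrow> lin_store \<Rightarrow> bool" where
  "satisfies v C \<longleftrightarrow> v \<in> carrier_vec (dim_col (fst C)) \<and>
     map_mat of_rat (fst C) *\<^sub>v v \<le> map_vec of_rat (snd C)"

definition sound_store :: "network \<Rightarrow> real vec set \<Rightarrow> lin_store \<Rightarrow> bool" where
  "sound_store \<N> R C \<longleftrightarrow> is_store (num_vars \<N>) C \<and> (\<forall>v. exact_feasible \<N> R v \<longrightarrow> satisfies v C)"

definition holds_at :: "rat vec \<Rightarrow> rat \<Rightarrow> real vec \<Rightarrow> bool" where
  "holds_at g \<tau> v \<longleftrightarrow> scalar_prod (map_vec of_rat g) v \<le> of_rat \<tau>"

definition valid_on :: "network \<Rightarrow> real vec set \<Rightarrow> rat vec \<Rightarrow> rat \<Rightarrow> bool" where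
  "valid_on \<N> R g \<tau> \<longleftrightarrow> (\<forall>v. exact_feasible \<N> R v \<longrightarrow> holds_at g \<tau> v)"

definition store_entails :: "lin_store \<Rightarrow> rat vec \<Rightarrow> rat \<Rightarrow> bool" where
  "store_entails C g \<tau> \<longleftrightarrow> (\<forall>v. satisfies v C \<longrightarrow> holds_at g \<tau> v)"

definition inject :: "rat vec \<Rightarrow> rat \<Rightarrow> lin_store \<Rightarrow> lin_store" where
  "inject g \<tau> C = (fst C @\<^sub>r mat_of_rows (dim_vec g) [g], snd C @\<^sub>v vec_of_list [\<tau>])"

definition dual_certificate :: "lin_store \<Rightarrow> rat vec \<Rightarrow> rat vec \<Rightarrow> bool" where
  "dual_certificate C g l \<longleftrightarrow> l \<in> carrier_vec (dim_row (fst C)) \<and>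
     0\<^sub>v (dim_row (fst C)) \<le> l \<and> transpose_mat (fst C) *\<^sub>v l = g"

definition dual_bound :: "lin_store \<Rightarrow> rat vec \<Rightarrow> rat" where
  "dual_bound C l = scalar_prod l (snd C)"

subsection \<open>Region trees and learned lemmas\<close>

datatype region_tree =
    Leaf (region: "real vec set") (store: lin_store)
  | Branch (region: "real vec set") (store: lin_store) region_tree region_tree

fun nodes :: "region_tree \<Rightarrow> region_tree set" where
  "nodes (Leaf R C) = {Leaf R C}"
| "nodes (Branch R C T1 T2) = insert (Branch R C T1 T2) (nodes T1 \<union> nodes T2)"

definition splits_into :: "real vec set \<Rightarrow> real vec set \<Rightarrow> real vec set \<Rightarrow> bool" where
  "splits_into R R1 R2 \<longleftrightarrow> R = R1 \<union> R2 \<and> R1 \<inter> R2 = {}"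

definition verification_tree :: "network \<Rightarrow> real vec set \<Rightarrow> region_tree \<Rightarrow> bool" where
  "verification_tree \<N> D T \<longleftrightarrow> region T = D \<and>
     (\<forall>P\<in>nodes T. is_store (num_vars \<N>) (store P)) \<and>
     (\<forall>R C T1 T2. Branch R C T1 T2 \<in> nodes T \<longrightarrow> splits_into R (region T1) (region T2))"

text \<open>
  An entailment certificate is either a dual vector for the store of the node itself, or a
  pair of certificates for its two children. Checking it only involves rational arithmetic.
\<close>

datatype certificate = Dual "rat vec" | Cases certificate certificate

fun checks :: "region_tree \<Rightarrow> rat vec \<Rightarrow> rat \<Rightarrow> certificate \<Rightarrow> bool" where
  "checks P g \<tau> (Dual l) \<longleftrightarrow> dual_certificate (store P) g l \<and> dual_bound (store P) l \<le> \<tau>"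
| "checks (Branch R C T1 T2) g \<tau> (Cases c1 c2) \<longleftrightarrow> checks T1 g \<tau> c1 \<and> checks T2 g \<tau> c2"
| "checks (Leaf R C) g \<tau> (Cases c1 c2) \<longleftrightarrow> False"

text \<open>
  A learned lemma at a node: valid under the exact constraints of the node, or entailed by
  its relaxation and valid on the whole domain; in both cases it comes with a certificate.
\<close>

definition learned_lemma ::
  "network \<Rightarrow> real vec set \<Rightarrow> region_tree \<Rightarrow> rat vec \<Rightarrow> rat \<Rightarrow> certificate \<Rightarrow> bool" where
  "learned_lemma \<N> D P g \<tau> c \<longleftrightarrow>
     (valid_on \<N> (region P) g \<tau> \<or> (store_entails (store P) g \<tau> \<and> valid_on \<N> D g \<tau>)) \<and>
     checks P g \<tau> c"

end

theory Submission
  imports Defs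
begin

text \<open>On each branch the bound is weak LP duality: if \<lambda> \<ge> 0 and \<lambda>^T A =
  g^T, then A v \<le> b gives g^T v = \<lambda>^T (A v) \<le> \<lambda>^T b
  (\<open>weak_duality\<close>). An exact-feasible point of the parent has its input in one of the
  two children, so by soundness it satisfies that child's store and hence the weaker bound max
  \<beta>1 \<beta>2 (\<open>valid_on_weaken\<close>, \<open>valid_on_Un\<close>). The two dual
  vectors together form the certificate at the parent. Reuse rests on
  \<open>sound_store_inject\<close>: appending a row that every exact-feasible point satisfies keeps
  a store sound.\<close>

lemma scalar_prod_map_of_rat:
  assumes "dim_vec u = dim_vec w"
  shows "scalar_prod (map_vec of_rat u) (map_vec of_rat w :: real vec) = of_rat (scalar_prod u w)"
  using assms by (simp add: scalar_prod_def of_rat_sum of_rat_mult)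

text \<open>Termwise monotonicity. \<open>scalar_prod\<close> sums over the indices of its right
  factor, which is why the zero vector takes its dimension from \<open>w\<close>.\<close>

lemma scalar_prod_left_mono:
  fixes l u w :: "'a :: ordered_semiring_0 vec"
  assumes "0\<^sub>v (dim_vec w) \<le> l" "u \<le> w"
  shows "scalar_prod l u \<le> scalar_prod l w"
  using assms by (auto simp: scalar_prod_def less_eq_vec_def intro!: sum_mono mult_left_mono)

lemma weak_duality:
  assumes store: "is_store N C" and cert: "dual_certificate C g l"
  shows "store_entails C g (dual_bound C l)"
  unfolding store_entails_def
proof (intro allI impI)
  fix v assume v: "satisfies v C"
  define r where "r = dim_row (fst C)"
  define A :: "real mat" where "A = map_mat of_rat (fst C)"
  define L :: "real vec" where "L = map_vec of_rat l"
  have A: "A \<in> carrier_mat r N" and b: "snd C \<in> carrier_vec r"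
    and l: "l \<in> carrier_vec r" "0\<^sub>v r \<le> l" and g: "transpose_mat (fst C) *\<^sub>v l = g"
    and vN: "v \<in> carrier_vec N" and Av: "A *\<^sub>v v \<le> map_vec of_rat (snd C)"
    using store cert v
    by (auto simp: is_store_def dual_certificate_def satisfies_def A_def r_def)
  have L: "L \<in> carrier_vec r" and L0: "0\<^sub>v (dim_vec (snd C)) \<le> L"
    using l b by (auto simp: L_def less_eq_vec_def)
  \<comment> \<open>The certificate is a rational identity while \<open>v\<close> is real;
    \<open>of_rat\<close> preserves sums and products, so the identity carries over entry by
    entry.\<close>
  have "map_vec of_rat g = transpose_mat A *\<^sub>v L"
    unfolding g[symmetric] A_def L_def
    using l by (intro eq_vecI) (auto simp: scalar_prod_def of_rat_sum of_rat_mult r_def)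
  \<comment> \<open>The transpose is the adjoint: (A^T L) . v = L . (A v).\<close>
  then have "scalar_prod (map_vec of_rat g) v = scalar_prod L (A *\<^sub>v v)"
    using transpose_vec_mult_scalar[OF A vN L] A L vN
    by (simp add: comm_scalar_prod[of _ N])
  also have "\<dots> \<le> scalar_prod L (map_vec of_rat (snd C))"
    using L0 Av by (intro scalar_prod_left_mono) auto
  also have "\<dots> = of_rat (dual_bound C l)"
    using l b by (simp add: L_def dual_bound_def scalar_prod_map_of_rat)
  finally show "holds_at g (dual_bound C l) v"
    by (simp add: holds_at_def)
qed

lemma valid_on_if_store_entails:
  assumes "sound_store \<N> R C" "store_entails C g \<tau>"
  shows "valid_on \<N> R g \<tau>"
  using assms by (auto simp: sound_store_def store_entails_def valid_on_def)

lemma valid_on_weaken: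
  assumes "valid_on \<N> R g \<tau>" "\<tau> \<le> \<tau>'"
  shows "valid_on \<N> R g \<tau>'"
proof -
  have "of_rat \<tau> \<le> (of_rat \<tau>' :: real)"
    using assms(2) by (simp add: of_rat_less_eq)
  then show ?thesis
    using assms(1) unfolding valid_on_def holds_at_def by (meson order_trans)
qed

lemma valid_on_subset:
  assumes "valid_on \<N> R g \<tau>" "R' \<subseteq> R"
  shows "valid_on \<N> R' g \<tau>"
  using assms by (auto simp: valid_on_def exact_feasible_def)

lemma valid_on_Un:
  assumes "valid_on \<N> R1 g \<tau>" "valid_on \<N> R2 g \<tau>"
  shows "valid_on \<N> (R1 \<union> R2) g \<tau>"
  using assms by (auto simp: valid_on_def exact_feasible_def)

lemma is_store_inject:
  assumes "is_store N C" "g \<in> carrier_vec N"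
  shows "is_store N (inject g \<tau> C)"
proof -
  define r where "r = dim_row (fst C)"
  have A: "fst C \<in> carrier_mat r N" and b: "snd C \<in> carrier_vec r"
    using assms(1) by (simp_all add: is_store_def r_def)
  have G: "mat_of_rows (dim_vec g) [g] \<in> carrier_mat 1 N"
    using assms(2) by (simp add: carrier_matI)
  have M: "fst (inject g \<tau> C) \<in> carrier_mat (r + 1) N"
    using carrier_append_rows[OF A G] by (simp add: inject_def)
  have "snd (inject g \<tau> C) \<in> carrier_vec (r + 1)"
    unfolding inject_def snd_conv by (intro append_carrier_vec[OF b] carrier_vecI) simp
  with M show ?thesis
    unfolding is_store_def carrier_matD(1)[OF M] by (rule conjI)
qed

text \<open>Lets the embedding into the reals, which \<open>satisfies\<close> applies to the whole
  stacked matrix, be applied block by block.\<close>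

lemma map_mat_append_rows:
  assumes "A \<in> carrier_mat r n" "B \<in> carrier_mat s n"
  shows "map_mat f (A @\<^sub>r B) = map_mat f A @\<^sub>r map_mat f B"
  using assms by (intro eq_matI) (auto simp: append_rows_def)

lemma satisfies_inject:
  assumes C: "is_store N C" and g: "g \<in> carrier_vec N"
    and v: "satisfies v C" "holds_at g \<tau> v"
  shows "satisfies v (inject g \<tau> C)"
proof -
  define r where "r = dim_row (fst C)"
  define h :: "rat \<Rightarrow> real" where "h = of_rat"
  define G where "G = mat_of_rows (dim_vec g) [g]"
  have A: "fst C \<in> carrier_mat r N" and b: "snd C \<in> carrier_vec r"
    using C by (simp_all add: is_store_def r_def)
  have G: "G \<in> carrier_mat 1 N"
    using g by (simp add: G_def carrier_matI)
  have vN: "v \<in> carrier_vec N" and Av: "map_mat h (fst C) *\<^sub>v v \<le> map_vec h (snd C)"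
    using v(1) A by (simp_all add: satisfies_def h_def)
  \<comment> \<open>The added block has this single row, so its matrix inequality is exactly
    \<open>holds_at\<close>.\<close>
  have "row (map_mat h G) 0 = map_vec h g"
    using g by (intro eq_vecI) (simp_all add: G_def mat_of_rows_def)
  then have Gv: "map_mat h G *\<^sub>v v \<le> map_vec h (vec_of_list [\<tau>])"
    using v(2) G by (simp add: less_eq_vec_def holds_at_def h_def)
  have "(map_mat h (fst C) @\<^sub>r map_mat h G) *\<^sub>v v
      \<le> map_vec h (snd C) @\<^sub>v map_vec h (vec_of_list [\<tau>])"
    using append_rows_le[of "map_mat h (fst C)" r N "map_mat h G" 1 "map_vec h (snd C)" v]
      A G b vN Av Gv by simp
  moreover have "map_vec h (snd C) @\<^sub>v map_vec h (vec_of_list [\<tau>]) = map_vec h (snd (inject g \<tau> C))"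
    by (intro eq_vecI) (simp_all add: inject_def)
  moreover have "map_mat h (fst C) @\<^sub>r map_mat h G = map_mat h (fst (inject g \<tau> C))"
    by (simp add: map_mat_append_rows[OF A G] inject_def G_def[symmetric])
  moreover have "dim_col (fst (inject g \<tau> C)) = N"
    using carrier_append_rows[OF A G] by (simp add: inject_def G_def)
  ultimately show ?thesis
    using vN by (simp add: satisfies_def h_def)
qed

text \<open>The new row only cuts off points violating the inequality, and validity says that none
  of these is exact-feasible on the region.\<close>

lemma sound_store_inject:
  assumes "sound_store \<N> R C" "valid_on \<N> R g \<tau>" "g \<in> carrier_vec (num_vars \<N>)"
  shows "sound_store \<N> R (inject g \<tau> C)"
  using assms is_store_inject satisfies_inject
  unfolding sound_store_def valid_on_def by blast

theorem theorem7p1: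
  fixes \<N> :: network and n m :: nat and D R R1 R2 :: "real vec set"
    and T T1 T2 :: region_tree and C C1 C2 :: lin_store
    and g l1 l2 :: "rat vec" and \<beta>1 \<beta>2 \<beta> :: rat
  assumes "is_network \<N> n m" and "compact_domain n D" and "verification_tree \<N> D T"
    and "Branch R C T1 T2 \<in> nodes T"
    and "R1 = region T1" and "R2 = region T2" and "C1 = store T1" and "C2 = store T2"
    and "R = R1 \<union> R2" and "R1 \<inter> R2 = {}"
    and "sound_store \<N> R1 C1" and "sound_store \<N> R2 C2"
    and "g \<in> carrier_vec (num_vars \<N>)"
    and "dual_certificate C1 g l1" and "dual_certificate C2 g l2"
    and "\<beta>1 = dual_bound C1 l1" and "\<beta>2 = dual_bound C2 l2" and "\<beta> = max \<beta>1 \<beta>2"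
  shows "store_entails C1 g \<beta>1 \<and> store_entails C2 g \<beta>2 \<and>
    valid_on \<N> R g \<beta> \<and>
    learned_lemma \<N> D (Branch R C T1 T2) g \<beta> (Cases (Dual l1) (Dual l2)) \<and>
    (\<forall>R' C'. R' \<subseteq> R \<longrightarrow> sound_store \<N> R' C' \<longrightarrow> sound_store \<N> R' (inject g \<beta> C'))"
proof -
  have stores: "is_store (num_vars \<N>) C1" "is_store (num_vars \<N>) C2"
    using assms(11,12) by (simp_all add: sound_store_def)
  have entails: "store_entails C1 g \<beta>1" "store_entails C2 g \<beta>2"
    using weak_duality[OF stores(1) assms(14)] weak_duality[OF stores(2) assms(15)] assms(16,17)
    by simp_all
  have "valid_on \<N> R1 g \<beta>"
    using valid_on_if_store_entails[OF assms(11) entails(1)] by (rule valid_on_weaken) (simp add: assms(18))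
  moreover have "valid_on \<N> R2 g \<beta>"
    using valid_on_if_store_entails[OF assms(12) entails(2)] by (rule valid_on_weaken) (simp add: assms(18))
  ultimately have valid: "valid_on \<N> R g \<beta>"
    unfolding assms(9) by (rule valid_on_Un)
  \<comment> \<open>Each dual vector is checked against its own child's store, where its bound is at
    most the maximum \<beta>.\<close>
  moreover have "checks (Branch R C T1 T2) g \<beta> (Cases (Dual l1) (Dual l2))"
    using assms(14,15) by (simp add: assms(7,8,16-18))
  \<comment> \<open>The first alternative of \<open>learned_lemma\<close> applies: validity under
    the exact constraints of the parent, obtained from the children's stores.\<close>
  ultimately have "learned_lemma \<N> D (Branch R C T1 T2) g \<beta> (Cases (Dual l1) (Dual l2))"
    by (simp add: learned_lemma_def)
  \<comment> \<open>Validity passes to subregions, so the lemma may enter any sound store below the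
    parent.\<close>
  moreover have "sound_store \<N> R' (inject g \<beta> C')" if "R' \<subseteq> R" "sound_store \<N> R' C'" for R' C'
    using that(2) valid_on_subset[OF valid that(1)] assms(13) by (rule sound_store_inject)
  ultimately show ?thesis
    using entails valid by simp
qed

end
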